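(* Let $\mathfrak{G}=(\mathcal{D},\mathcal{B})$ be an mDAG whose simplicial complex $\mathcal{B}$ contains two disjoint faces $C$ and $D$. Let $\mathfrak{G}'$ be the mDAG obtained from $\mathfrak{G}$ by adding to its simplicial complex (if not already present) the set $B=C\cup D$ and all of the faces contained in $B$ (the directed structure being unchanged). Suppose that: 1. $\mathrm{pa}_{\mathcal{D}}(C)\cup C\subseteq\mathrm{pa}_{\mathcal{D}}(d)$ for each $d\in D$; 2. for every facet $B'$ of $\mathcal{B}$ such that $B'\not\subseteq C$, if $c\in B'$ for some $c\in C$, then $D\subset B'$. Then $\mathfrak{G}$ observationally dominates $\mathfrak{G}'$, i.e. $\mathfrak{G}\succeq\mathfrak{G}'$; and hence (since $\mathfrak{G}'$ structurally, and therefore observationally, dominates $\mathfrak{G}$) $\mathfrak{G}$ and $\mathfrak{G}'$ are observationally equivalent, $\mathfrak{G}\cong\mathfrak{G}'$.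
   Context: A pDAG $\mathcal{G}$ is a finite directed acyclic graph (DAG) whose nodes are partitioned into visible nodes $V$ and latent nodes $L$. Let $\mathrm{pa}_{\mathcal{G}}(a)$ denote the set of parents of node $a$, and $\mathrm{pa}_{\mathcal{G}}(S)=\bigcup_{a\in S}\mathrm{pa}_{\mathcal{G}}(a)$. For a vector $\vec c\in\mathbb{N}^{V}$ of (positive) cardinalities, $\mathcal{M}(\mathcal{G},\vec c)$ is the set of all probability distributions $P$ of $(X_v)_{v\in V}$, where $X_v$ takes values in a fixed set of size $c_v$, that can be written $$P(X_V)=\sum_{X_L}\sum_{E}\ \prod_{a\in V\cup L}\delta_{X_a,\,f_a(X_{\mathrm{pa}_{\mathcal{G}}(a)},E_a)}\,P(E_a)$$ for some choice of finite state spaces of arbitrary size for the latent variables $X_l$ ($l\in L$), of finite error variables $E_a$ with distributions $P(E_a)$ (one for each node $a$), and of functions $f_a$. An mDAG is a pair $\mathfrak{G}=(\mathcal{D},\mathcal{B})$, where $\mathcal{D}$ is a DAG (the directed structure) and $\mathcal{B}$ is a simplicial complex over the nodes of $\mathcal{D}$: a set of subsets of the node set that contains all singletons and is closed under taking subsets. Elements of $\mathcal{B}$ are faces; inclusion-maximal elements are facets. The canonical pDAG $\mathrm{can}(\mathfrak{G})$ has as visible nodes the nodes of $\mathcal{D}$, all edges of $\mathcal{D}$, and in addition, for each facet $A$ of $\mathcal{B}$, one parentless latent node whose set of children is exactly $A$. Put $\mathcal{M}(\mathfrak{G},\vec c)=\mathcal{M}(\mathrm{can}(\mathfrak{G}),\vec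 c)$. For two mDAGs with the same nodes, $\mathfrak{G}$ observationally dominates $\mathfrak{G}'$ ($\mathfrak{G}\succeq\mathfrak{G}'$) if $\mathcal{M}(\mathfrak{G}',\vec c)\subseteq\mathcal{M}(\mathfrak{G},\vec c)$ for every $\vec c$; they are observationally equivalent ($\mathfrak{G}\cong\mathfrak{G}'$) if equality holds for every $\vec c$. $\mathfrak{G}=(\mathcal D,\mathcal B)$ structurally dominates $\mathfrak{G}'=(\mathcal D',\mathcal B')$ if every edge of $\mathcal{D}'$ is an edge of $\mathcal{D}$ and $\mathcal{B}'\subseteq\mathcal{B}$; structural dominance implies observational dominance. *)

theory Defs
  imports "HOL-Probability.Probability_Mass_Function"
begin

definition parents :: "'a rel \<Rightarrow> 'a set \<Rightarrow> 'a set" where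
  "parents E S = (\<Union>a\<in>S. {b. (b, a) \<in> E})"

text \<open>
  The partition of the nodes into visible and latent ones is encoded by the two summands of the
  node type, so that assignments of the visible variables are functions on the type of visible
  nodes alone.
\<close>

record ('v, 'l) pdag =
  visible :: "'v set"
  latent :: "'l set"
  edges :: "('v + 'l) rel"

definition pnodes :: "('v, 'l) pdag \<Rightarrow> ('v + 'l) set" where
  "pnodes G = visible G <+> latent G"

definition is_pdag :: "('v, 'l) pdag \<Rightarrow> bool" where
  "is_pdag G \<longleftrightarrow> finite (visible G) \<and> finite (latent G) \<and>
     edges G \<subseteq> pnodes G \<times> pnodes G \<and> acyclic (edges G)"

text \<open>
  All variables take values in initial segments of the naturals, which serve as the fixed sets of
  the given finite sizes: \<open>c v\<close> for a visible node \<open>v\<close>, \<open>k l\<close> for a latent node \<open>l\<close>, and \<open>m a\<close>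
  for the error variable of a node \<open>a\<close>, whose distribution is \<open>Q a\<close>. The sizes \<open>k\<close> and \<open>m\<close> are
  existentially quantified. Assignments are extensional functions, and \<open>case_sum x y\<close> is the joint
  assignment of all nodes obtained from \<open>x\<close> on the visible and \<open>y\<close> on the latent nodes.
\<close>

definition pdag_model :: "('v, 'l) pdag \<Rightarrow> ('v \<Rightarrow> nat) \<Rightarrow> ('v \<Rightarrow> nat) pmf set" where
  "pdag_model G c = {P.
     set_pmf P \<subseteq> (\<Pi>\<^sub>E v\<in>visible G. {..<c v}) \<and>
     (\<exists>(k :: 'l \<Rightarrow> nat) (m :: 'v + 'l \<Rightarrow> nat) (Q :: 'v + 'l \<Rightarrow> nat pmf)
       (f :: 'v + 'l \<Rightarrow> ('v + 'l \<Rightarrow> nat) \<Rightarrow> nat \<Rightarrow> nat).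
        (\<forall>a\<in>pnodes G. set_pmf (Q a) \<subseteq> {..<m a}) \<and>
        (\<forall>a\<in>pnodes G. \<forall>z\<in>(\<Pi>\<^sub>E b\<in>parents (edges G) {a}. {..<case_sum c k b}). \<forall>e<m a.
           f a z e < case_sum c k a) \<and>
        (\<forall>x\<in>(\<Pi>\<^sub>E v\<in>visible G. {..<c v}).
           pmf P x =
             (\<Sum>y\<in>(\<Pi>\<^sub>E l\<in>latent G. {..<k l}). \<Sum>e\<in>(\<Pi>\<^sub>E a\<in>pnodes G. {..<m a}).
                \<Prod>a\<in>pnodes G.
                  of_bool (case_sum x y a =
                    f a (restrict (case_sum x y) (parents (edges G) {a})) (e a))
                  * pmf (Q a) (e a))))}"

record 'v mdag =
  nodes :: "'v set"
  directed :: "'v rel"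
  faces :: "'v set set"

definition is_mdag :: "'v mdag \<Rightarrow> bool" where
  "is_mdag G \<longleftrightarrow> finite (nodes G) \<and>
     directed G \<subseteq> nodes G \<times> nodes G \<and> acyclic (directed G) \<and>
     faces G \<subseteq> Pow (nodes G) \<and> (\<forall>v\<in>nodes G. {v} \<in> faces G) \<and>
     (\<forall>A\<in>faces G. \<forall>A'. A' \<subseteq> A \<longrightarrow> A' \<in> faces G)"

definition facets :: "'v mdag \<Rightarrow> 'v set set" where
  "facets G = {A \<in> faces G. \<forall>A'\<in>faces G. A \<subseteq> A' \<longrightarrow> A' = A}"

definition can :: "'v mdag \<Rightarrow> ('v, 'v set) pdag" where
  "can G = \<lparr>visible = nodes G, latent = facets G,
     edges = {(Inl a, Inl b) | a b. (a, b) \<in> directed G} \<union>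
             {(Inr A, Inl a) | A a. A \<in> facets G \<and> a \<in> A}\<rparr>"

definition mdag_model :: "'v mdag \<Rightarrow> ('v \<Rightarrow> nat) \<Rightarrow> ('v \<Rightarrow> nat) pmf set" where
  "mdag_model G c = pdag_model (can G) c"

definition obs_dominates :: "'v mdag \<Rightarrow> 'v mdag \<Rightarrow> bool" where
  "obs_dominates G G' \<longleftrightarrow> nodes G = nodes G' \<and>
     (\<forall>c. (\<forall>v\<in>nodes G. 0 < c v) \<longrightarrow> mdag_model G' c \<subseteq> mdag_model G c)"

definition obs_equivalent :: "'v mdag \<Rightarrow> 'v mdag \<Rightarrow> bool" where
  "obs_equivalent G G' \<longleftrightarrow> nodes G = nodes G' \<and>
     (\<forall>c. (\<forall>v\<in>nodes G. 0 < c v) \<longrightarrow> mdag_model G c = mdag_model G' c)"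

definition add_face :: "'v mdag \<Rightarrow> 'v set \<Rightarrow> 'v mdag" where
  "add_face G B = G\<lparr>faces := faces G \<union> Pow B\<rparr>"

lemma is_mdag_add_face:
  assumes "is_mdag G" "B \<subseteq> nodes G"
  shows "is_mdag (add_face G B)"
  using assms unfolding is_mdag_def add_face_def by auto

lemma is_pdag_can:
  assumes "is_mdag G"
  shows "is_pdag (can G)"
proof -
  have fin: "finite (nodes G)" and dir: "directed G \<subseteq> nodes G \<times> nodes G"
    and acyc: "acyclic (directed G)" and faces: "faces G \<subseteq> Pow (nodes G)"
    using assms by (auto simp: is_mdag_def)
  have "finite (facets G)"
    using fin faces by (auto simp: facets_def intro: finite_subset[of _ "Pow (nodes G)"])
  moreover have "edges (can G) \<subseteq> pnodes (can G) \<times> pnodes (can G)"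
    using dir faces by (auto simp: can_def pnodes_def facets_def)
  moreover have "acyclic (edges (can G))"
  proof -
    have latent: "(z, Inr A) \<notin> (edges (can G))\<^sup>+" for z A
      by (auto simp: can_def elim: tranclE)
    have visible: "(z, w) \<in> (edges (can G))\<^sup>+ \<Longrightarrow>
        \<forall>a b. z = Inl a \<longrightarrow> w = Inl b \<longrightarrow> (a, b) \<in> (directed G)\<^sup>+" for z w
    proof (induction rule: trancl_induct)
      case (base w)
      then show ?case by (auto simp: can_def)
    next
      case (step w u)
      obtain b where "w = Inl b"
        using step.hyps(1) latent by (cases w) auto
      then show ?case
        using step by (auto simp: can_def intro: trancl_into_trancl)
    qed
    show ?thesis
      unfolding acyclic_def
    proof (intro allI notI)
      fix z assume z: "(z, z) \<in> (edges (can G))\<^sup>+"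
      then obtain a where "z = Inl a"
        using latent by (metis sum.exhaust)
      then have "(a, a) \<in> (directed G)\<^sup>+"
        using visible[OF z] by blast
      then show False
        using acyc by (simp add: acyclic_def)
    qed
  qed
  ultimately show ?thesis
    using fin by (simp add: is_pdag_def can_def)
qed

end

theory Submission
  imports Defs "HOL-Probability.Product_PMF"
begin

text \<open>
  Only the case where \<open>B = C \<union> D\<close> is not yet a face needs an argument. By Bayes' rule, the latent
  variable \<open>\<lambda>\<close> of the new facet \<open>B\<close> may be generated in two steps: one copy of \<open>\<lambda>\<close> drives the nodes
  of \<open>C\<close>, and a second copy, drawn from the posterior of \<open>\<lambda>\<close> given the values of \<open>C\<close>, of its
  parents and of the other latent variables acting on \<open>C\<close>, drives the nodes of \<open>D\<close>. By the two
  hypotheses every node of \<open>D\<close> sees everything the posterior depends on, so it can compute the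
  second copy from a single noise variable shared by \<open>D\<close>, namely a random response function that
  picks a posterior sample for every possible conditioning value. Thus the latent variable on \<open>B\<close>
  is replaced by one on the face \<open>C\<close> and one on the face \<open>D\<close>, and these can be absorbed into the
  latent variables of facets containing \<open>C\<close> and \<open>D\<close>.
\<close>

section \<open>Finite sums over assignments, random functions and normalisation\<close>

lemma pmf_map_sum_nat:
  fixes Q :: "nat pmf"
  assumes "set_pmf Q \<subseteq> {..<m}"
  shows "pmf (map_pmf g Q) t = (\<Sum>e<m. of_bool (t = g e) * pmf Q e)"
proof -
  have "pmf (map_pmf g Q) t = (LINT e|measure_pmf Q. of_bool (t = g e))"
    by (simp add: map_pmf_def pmf_bind indicator_def of_bool_def eq_commute)
  also have "\<dots> = (\<Sum>e<m. of_bool (t = g e) * pmf Q e)"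
    using assms by (intro integral_measure_pmf_real) auto
  finally show ?thesis .
qed

lemma sum_PiE_insert:
  assumes "finite I" "i \<notin> I" "finite (S i)" "\<And>j. j \<in> I \<Longrightarrow> finite (S j)"
  shows "(\<Sum>y\<in>PiE (insert i I) S. f y) = (\<Sum>a\<in>S i. \<Sum>y\<in>PiE I S. f (y(i := a)))"
proof -
  have "(\<Sum>y\<in>PiE (insert i I) S. f y) = (\<Sum>(a, y)\<in>S i \<times> PiE I S. f (y(i := a)))"
    unfolding PiE_insert_eq
    by (subst sum.reindex[OF inj_combinator[OF assms(2)]]) (simp add: case_prod_unfold)
  also have "\<dots> = (\<Sum>a\<in>S i. \<Sum>y\<in>PiE I S. f (y(i := a)))"
    by (simp add: sum.cartesian_product)
  finally show ?thesis .
qed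

text \<open>Assignments outside the supports contribute a zero factor. This lets latent ranges pass
  between supports and the initial segments that \<open>pdag_model\<close> uses.\<close>

lemma sum_PiE_set_pmf:
  fixes f :: "('i \<Rightarrow> 'b) \<Rightarrow> real"
  assumes "finite I" "\<And>i. i \<in> I \<Longrightarrow> finite (S i)" "\<And>i. i \<in> I \<Longrightarrow> set_pmf (q i) \<subseteq> S i"
  shows "(\<Sum>y\<in>PiE I S. (\<Prod>i\<in>I. pmf (q i) (y i)) * f y) =
         (\<Sum>y\<in>PiE I (\<lambda>i. set_pmf (q i)). (\<Prod>i\<in>I. pmf (q i) (y i)) * f y)"
proof (rule sum.mono_neutral_right)
  show "finite (PiE I S)" using assms by (intro finite_PiE) auto
  show "PiE I (\<lambda>i. set_pmf (q i)) \<subseteq> PiE I S" using assms by (intro PiE_mono) auto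
  show "\<forall>y\<in>PiE I S - PiE I (\<lambda>i. set_pmf (q i)). (\<Prod>i\<in>I. pmf (q i) (y i)) * f y = 0"
  proof
    fix y assume y: "y \<in> PiE I S - PiE I (\<lambda>i. set_pmf (q i))"
    then obtain i where "i \<in> I" "y i \<notin> set_pmf (q i)" by (auto simp: PiE_iff)
    then have "pmf (q i) (y i) = 0" by (simp add: set_pmf_iff)
    then show "(\<Prod>i\<in>I. pmf (q i) (y i)) * f y = 0"
      using \<open>i \<in> I\<close> assms(1) by (auto intro: prod_zero)
  qed
qed

text \<open>The noise \<open>Q\<close> encodes a random function, with independent values \<open>K z\<close> at the points \<open>z\<close>.\<close>

lemma finite_kernel_function:
  fixes K :: "'z \<Rightarrow> nat pmf"
  assumes Z: "finite Z" and K: "\<And>z. z \<in> Z \<Longrightarrow> set_pmf (K z) \<subseteq> S" and S: "finite S"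
  obtains Q :: "nat pmf" and m :: nat and f where "set_pmf Q = {..<m}"
    "\<And>z e. z \<in> Z \<Longrightarrow> e < m \<Longrightarrow> f z e \<in> S" "\<And>z. z \<in> Z \<Longrightarrow> map_pmf (f z) Q = K z"
proof -
  \<comment> \<open>With the default \<open>0\<close> outside \<open>Z\<close> the support stays
    finite, so a whole response function is coded by one natural number; \<open>f\<close> decodes
    this number and evaluates at \<open>z\<close>.\<close>
  define T where "T = set_pmf (Pi_pmf Z 0 K)"
  have T: "T = PiE_dflt Z 0 (set_pmf \<circ> K)"
    unfolding T_def by (rule set_Pi_pmf[OF Z])
  have "finite T"
    unfolding T using K S by (intro finite_PiE_dflt Z) (auto intro: finite_subset)
  then obtain h where h: "bij_betw h T {..<card T}"
    using to_nat_on_finite by blast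
  define f where "f = (\<lambda>z e. inv_into T h e z)"
  define Q where "Q = map_pmf h (Pi_pmf Z 0 K)"
  have inv: "inv_into T h (h w) = w" if "w \<in> T" for w
    using h that by (simp add: bij_betw_def)
  show thesis
  proof (rule that)
    show "set_pmf Q = {..<card T}"
      using h by (simp add: Q_def T_def[symmetric] bij_betw_def)
    show "f z e \<in> S" if "z \<in> Z" "e < card T" for z e
    proof -
      have "inv_into T h e \<in> T"
        using h that by (auto simp: bij_betw_def intro: inv_into_into)
      then show ?thesis using K[OF that(1)] that(1) by (auto simp: T PiE_dflt_def f_def)
    qed
    show "map_pmf (f z) Q = K z" if "z \<in> Z" for z
    proof -
      have "map_pmf (f z) Q = map_pmf (\<lambda>w. w z) (Pi_pmf Z 0 K)"
        unfolding Q_def pmf.map_comp using inv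
        by (intro map_pmf_cong) (auto simp: f_def T_def)
      also have "\<dots> = K z" using that Z by (simp add: Pi_pmf_component)
      finally show ?thesis .
    qed
  qed
qed

text \<open>A positive total is divided out; if the total is \<open>0\<close>, all weights vanish
  and any distribution on \<open>S\<close> will do. The product form covers both cases and later
  serves as Bayes' rule with evidence \<open>sum g S\<close>.\<close>

lemma normalised_pmf:
  fixes g :: "'b \<Rightarrow> real"
  assumes "finite S" "S \<noteq> {}" "\<And>b. b \<in> S \<Longrightarrow> 0 \<le> g b"
  obtains p where "set_pmf p \<subseteq> S" "\<And>b. b \<in> S \<Longrightarrow> pmf p b * sum g S = g b"
proof (cases "sum g S = 0")
  case True
  then have "g b = 0" if "b \<in> S" for b
    using assms that by (simp add: sum_nonneg_eq_0_iff)
  then show ?thesis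
    using that[of "pmf_of_set S"] assms True by (simp add: set_pmf_of_set)
next
  case False
  define h where "h = (\<lambda>b. if b \<in> S then g b / sum g S else 0)"
  have nn: "0 \<le> h b" for b
    using assms by (auto simp: h_def intro: divide_nonneg_nonneg sum_nonneg)
  have "(\<integral>\<^sup>+ b. ennreal (h b) \<partial>count_space UNIV) = (\<Sum>b\<in>S. ennreal (h b))"
    using assms(1) by (intro nn_integral_count_space') (auto simp: h_def)
  also have "\<dots> = ennreal (\<Sum>b\<in>S. h b)" using nn by simp
  also have "(\<Sum>b\<in>S. h b) = 1"
    using False by (simp add: h_def flip: sum_divide_distrib)
  finally have one: "(\<integral>\<^sup>+ b. ennreal (h b) \<partial>count_space UNIV) = 1" by simp
  have "pmf (embed_pmf h) b = h b" for b using nn one by (rule pmf_embed_pmf)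
  moreover have "set_pmf (embed_pmf h) \<subseteq> S"
    using set_embed_pmf[of h] nn one by (auto simp: h_def split: if_splits)
  ultimately show ?thesis
    using False that[of "embed_pmf h"] by (simp add: h_def)
qed

section \<open>Models with the error variables summed out\<close>

text \<open>
  The model with the error variables summed out: the latent variable \<open>i\<close> has distribution \<open>q i\<close> and
  children \<open>ch i\<close>, and \<open>K v\<close> is the conditional distribution of node \<open>v\<close>. The latter takes full
  assignments as arguments; the third conjunct says that only those of the parents matter.
\<close>

definition latent_rep ::
  "'v set \<Rightarrow> 'v rel \<Rightarrow> ('v \<Rightarrow> nat) \<Rightarrow> 'i set \<Rightarrow> ('i \<Rightarrow> 'v set) \<Rightarrow> ('i \<Rightarrow> 'b pmf) \<Rightarrow>
   ('v \<Rightarrow> ('v \<Rightarrow> nat) \<Rightarrow> ('i \<Rightarrow> 'b) \<Rightarrow> nat pmf) \<Rightarrow> ('v \<Rightarrow> nat) pmf \<Rightarrow> bool" where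
  "latent_rep V E c I ch q K P \<longleftrightarrow>
     (\<forall>i\<in>I. finite (set_pmf (q i))) \<and>
     (\<forall>v\<in>V. \<forall>x y. set_pmf (K v x y) \<subseteq> {..<c v}) \<and>
     (\<forall>v\<in>V. \<forall>x x' y y'. (\<forall>u\<in>parents E {v}. x u = x' u) \<longrightarrow>
        (\<forall>i\<in>I. v \<in> ch i \<longrightarrow> y i = y' i) \<longrightarrow> K v x y = K v x' y') \<and>
     (\<forall>x\<in>(\<Pi>\<^sub>E v\<in>V. {..<c v}).
        pmf P x = (\<Sum>y\<in>(\<Pi>\<^sub>E i\<in>I. set_pmf (q i)).
                     (\<Prod>i\<in>I. pmf (q i) (y i)) * (\<Prod>v\<in>V. pmf (K v x y) (x v))))"

lemma latent_repD:
  assumes "latent_rep V E c I ch q K P"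
  shows latent_rep_finite: "i \<in> I \<Longrightarrow> finite (set_pmf (q i))"
    and latent_rep_set: "v \<in> V \<Longrightarrow> set_pmf (K v x y) \<subseteq> {..<c v}"
    and latent_rep_local: "v \<in> V \<Longrightarrow> (\<And>u. u \<in> parents E {v} \<Longrightarrow> x u = x' u) \<Longrightarrow>
      (\<And>i. i \<in> I \<Longrightarrow> v \<in> ch i \<Longrightarrow> y i = y' i) \<Longrightarrow> K v x y = K v x' y'"
    and latent_rep_pmf: "x \<in> (\<Pi>\<^sub>E v\<in>V. {..<c v}) \<Longrightarrow>
      pmf P x = (\<Sum>y\<in>(\<Pi>\<^sub>E i\<in>I. set_pmf (q i)).
                   (\<Prod>i\<in>I. pmf (q i) (y i)) * (\<Prod>v\<in>V. pmf (K v x y) (x v)))"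
proof -
  note rep = assms[unfolded latent_rep_def]
  show "i \<in> I \<Longrightarrow> finite (set_pmf (q i))"
    using rep[THEN conjunct1] by blast
  show "v \<in> V \<Longrightarrow> set_pmf (K v x y) \<subseteq> {..<c v}"
    using rep[THEN conjunct2, THEN conjunct1] by blast
  show "K v x y = K v x' y'" if "v \<in> V" "\<And>u. u \<in> parents E {v} \<Longrightarrow> x u = x' u"
    "\<And>i. i \<in> I \<Longrightarrow> v \<in> ch i \<Longrightarrow> y i = y' i"
    by (rule rep[THEN conjunct2, THEN conjunct2, THEN conjunct1, rule_format]) (use that in blast)+
  show "x \<in> (\<Pi>\<^sub>E v\<in>V. {..<c v}) \<Longrightarrow>
      pmf P x = (\<Sum>y\<in>(\<Pi>\<^sub>E i\<in>I. set_pmf (q i)).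
                   (\<Prod>i\<in>I. pmf (q i) (y i)) * (\<Prod>v\<in>V. pmf (K v x y) (x v)))"
    using rep[THEN conjunct2, THEN conjunct2, THEN conjunct2] by (rule bspec)
qed

section \<open>Relabelling and merging latent variables\<close>

text \<open>Only the supports matter, and these are countable, so their elements can be numbered and
  the kernels can decode first. Merging produces latent values that are functions, whereas the model
  asks for naturals.\<close>

lemma latent_rep_encode:
  fixes q :: "'i \<Rightarrow> 'b pmf"
  assumes rep: "latent_rep V E c I ch q K P"
  shows "\<exists>(q' :: 'i \<Rightarrow> nat pmf) K'. latent_rep V E c I ch q' K' P"
proof -
  define h where "h = (\<lambda>i. to_nat_on (set_pmf (q i)))"
  define g where "g = (\<lambda>i. from_nat_into (set_pmf (q i)))"
  define q' where "q' = (\<lambda>i. map_pmf (h i) (q i))"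
  define K' where "K' = (\<lambda>v x y. K v x (\<lambda>i. g i (y i)))"
  have gh: "g i (h i b) = b" if "b \<in> set_pmf (q i)" for i b
    using that by (simp add: g_def h_def)
  have pmf_h: "pmf (q' i) (h i b) = pmf (q i) b" if "b \<in> set_pmf (q i)" for i b
    unfolding q'_def using that gh by (intro pmf_map_inj inj_on_inverseI[where g = "g i"]) auto
  have loc: "K v x y = K v x y'" if "v \<in> V" "\<And>i. i \<in> I \<Longrightarrow> y i = y' i" for v x y y'
    using that by (intro latent_rep_local[OF rep]) auto
  have "latent_rep V E c I ch q' K' P"
    unfolding latent_rep_def
  proof (intro conjI ballI allI impI)
    fix x assume x: "x \<in> (\<Pi>\<^sub>E v\<in>V. {..<c v})"
    have "(\<Sum>y\<in>(\<Pi>\<^sub>E i\<in>I. set_pmf (q i)).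
             (\<Prod>i\<in>I. pmf (q i) (y i)) * (\<Prod>v\<in>V. pmf (K v x y) (x v))) =
          (\<Sum>y\<in>(\<Pi>\<^sub>E i\<in>I. set_pmf (q' i)).
             (\<Prod>i\<in>I. pmf (q' i) (y i)) * (\<Prod>v\<in>V. pmf (K' v x y) (x v)))"
    proof (rule sum.reindex_bij_witness[where
          i = "\<lambda>y. \<lambda>i\<in>I. g i (y i)" and j = "\<lambda>y. \<lambda>i\<in>I. h i (y i)"])
      fix y assume y: "y \<in> (\<Pi>\<^sub>E i\<in>I. set_pmf (q i))"
      then have yi: "y i \<in> set_pmf (q i)" if "i \<in> I" for i using that by auto
      show "(\<lambda>i\<in>I. g i ((\<lambda>i\<in>I. h i (y i)) i)) = y"
        using y yi by (auto simp: fun_eq_iff gh[OF yi] PiE_def extensional_def)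
      show "(\<lambda>i\<in>I. h i (y i)) \<in> (\<Pi>\<^sub>E i\<in>I. set_pmf (q' i))"
        using yi by (auto simp: q'_def)
      have "K' v x (\<lambda>i\<in>I. h i (y i)) = K v x y" if "v \<in> V" for v
        unfolding K'_def using yi by (intro loc[OF that]) (simp add: gh)
      then show "(\<Prod>i\<in>I. pmf (q' i) ((\<lambda>i\<in>I. h i (y i)) i)) *
           (\<Prod>v\<in>V. pmf (K' v x (\<lambda>i\<in>I. h i (y i))) (x v)) =
         (\<Prod>i\<in>I. pmf (q i) (y i)) * (\<Prod>v\<in>V. pmf (K v x y) (x v))"
        using yi by (simp add: pmf_h)
    next
      fix y assume y: "y \<in> (\<Pi>\<^sub>E i\<in>I. set_pmf (q' i))"
      have yi: "g i (y i) \<in> set_pmf (q i) \<and> h i (g i (y i)) = y i" if "i \<in> I" for i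
        using y that gh by (force simp: q'_def PiE_iff)
      show "(\<lambda>i\<in>I. h i ((\<lambda>i\<in>I. g i (y i)) i)) = y"
        using y yi by (auto simp: fun_eq_iff PiE_def extensional_def)
      show "(\<lambda>i\<in>I. g i (y i)) \<in> (\<Pi>\<^sub>E i\<in>I. set_pmf (q i))"
        using yi by auto
    qed
    then show "pmf P x = (\<Sum>y\<in>(\<Pi>\<^sub>E i\<in>I. set_pmf (q' i)).
             (\<Prod>i\<in>I. pmf (q' i) (y i)) * (\<Prod>v\<in>V. pmf (K' v x y) (x v)))"
      using latent_rep_pmf[OF rep x] by simp
  next
    fix v x y assume "v \<in> V"
    then show "set_pmf (K' v x y) \<subseteq> {..<c v}"
      unfolding K'_def by (rule latent_rep_set[OF rep])
  next
    fix v and x x' :: "_ \<Rightarrow> nat" and y y' :: "_ \<Rightarrow> nat"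
    assume "v \<in> V" "\<forall>u\<in>parents E {v}. x u = x' u" "\<forall>i\<in>I. v \<in> ch i \<longrightarrow> y i = y' i"
    then show "K' v x y = K' v x' y'"
      unfolding K'_def by (intro latent_rep_local[OF rep]) auto
  next
    fix i assume "i \<in> I"
    then show "finite (set_pmf (q' i))"
      using latent_rep_finite[OF rep] by (simp add: q'_def)
  qed
  then show ?thesis by blast
qed

text \<open>A latent variable may be carried by any \<open>j\<close> whose children include its own:
  each \<open>j\<close> holds the tuple of the independent variables sent to it, and each node reads
  off the components it used before. An index that receives nothing carries a constant.\<close>

lemma latent_rep_merge:
  fixes q :: "'i \<Rightarrow> 'b pmf" and F :: "'i \<Rightarrow> 'j"
  assumes I: "finite I" and J: "finite J" and rep: "latent_rep V E c I ch q K P"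
    and F: "\<And>i. i \<in> I \<Longrightarrow> F i \<in> J" "\<And>i. i \<in> I \<Longrightarrow> ch i \<subseteq> ch' (F i)"
  shows "\<exists>(q' :: 'j \<Rightarrow> ('i \<Rightarrow> 'b) pmf) K'. latent_rep V E c J ch' q' K' P"
proof -
  define A where "A = (\<lambda>j. {i\<in>I. F i = j})"
  \<comment> \<open>The default \<open>undefined\<close> makes the support exactly the set of
    extensional tuples, so restrictions of \<open>y\<close> to blocks match it literally.\<close>
  define q' where "q' = (\<lambda>j. Pi_pmf (A j) undefined q)"
  define K' where "K' = (\<lambda>v x (y :: 'j \<Rightarrow> 'i \<Rightarrow> 'b). K v x (\<lambda>i. y (F i) i))"
  have finA: "finite (A j)" for j using I by (simp add: A_def)
  have set_q': "set_pmf (q' j) = PiE (A j) (\<lambda>i. set_pmf (q i))" for j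
    unfolding q'_def set_Pi_pmf[OF finA]
    by (auto simp: PiE_dflt_def PiE_iff extensional_def)
  have loc: "K v x y = K v x y'" if "v \<in> V" "\<And>i. i \<in> I \<Longrightarrow> y i = y' i" for v x y y'
    using that by (intro latent_rep_local[OF rep]) auto
  have "latent_rep V E c J ch' q' K' P"
    unfolding latent_rep_def
  proof (intro conjI ballI allI impI)
    fix x assume x: "x \<in> (\<Pi>\<^sub>E v\<in>V. {..<c v})"
    have "(\<Sum>y\<in>(\<Pi>\<^sub>E i\<in>I. set_pmf (q i)).
             (\<Prod>i\<in>I. pmf (q i) (y i)) * (\<Prod>v\<in>V. pmf (K v x y) (x v))) =
          (\<Sum>y\<in>(\<Pi>\<^sub>E j\<in>J. set_pmf (q' j)).
             (\<Prod>j\<in>J. pmf (q' j) (y j)) * (\<Prod>v\<in>V. pmf (K' v x y) (x v)))"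
    proof (rule sum.reindex_bij_witness[where
          i = "\<lambda>y. \<lambda>i\<in>I. y (F i) i" and j = "\<lambda>y. \<lambda>j\<in>J. restrict y (A j)"])
      fix y assume y: "y \<in> (\<Pi>\<^sub>E i\<in>I. set_pmf (q i))"
      let ?y = "\<lambda>j\<in>J. restrict y (A j)"
      have y_eq: "?y (F i) i = y i" if "i \<in> I" for i
        using that F by (simp add: A_def)
      show "(\<lambda>i\<in>I. ?y (F i) i) = y"
        using y y_eq by (auto simp: fun_eq_iff PiE_def extensional_def)
      show "?y \<in> (\<Pi>\<^sub>E j\<in>J. set_pmf (q' j))"
        using y by (auto simp: set_q' A_def split: if_splits)
      have "pmf (q' j) (?y j) = (\<Prod>i\<in>A j. pmf (q i) (y i))" if "j \<in> J" for j
        unfolding q'_def using that by (subst pmf_Pi'[OF finA]) auto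
      then have "(\<Prod>j\<in>J. pmf (q' j) (?y j)) = (\<Prod>j\<in>J. \<Prod>i\<in>A j. pmf (q i) (y i))"
        by simp
      also have "\<dots> = (\<Prod>i\<in>I. pmf (q i) (y i))"
        unfolding A_def using F by (intro prod.group I J) auto
      finally have *: "(\<Prod>j\<in>J. pmf (q' j) (?y j)) = (\<Prod>i\<in>I. pmf (q i) (y i))" .
      have "K' v x ?y = K v x y" if "v \<in> V" for v
        unfolding K'_def using y_eq by (intro loc[OF that])
      then show "(\<Prod>j\<in>J. pmf (q' j) (?y j)) * (\<Prod>v\<in>V. pmf (K' v x ?y) (x v)) =
         (\<Prod>i\<in>I. pmf (q i) (y i)) * (\<Prod>v\<in>V. pmf (K v x y) (x v))"
        using * by simp
    next
      fix y assume y: "y \<in> (\<Pi>\<^sub>E j\<in>J. set_pmf (q' j))"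
      then have yj: "y j \<in> PiE (A j) (\<lambda>i. set_pmf (q i))" if "j \<in> J" for j
        using that set_q' by blast
      show "(\<lambda>i\<in>I. y (F i) i) \<in> (\<Pi>\<^sub>E i\<in>I. set_pmf (q i))"
        using yj[OF F(1)] by (fastforce simp: A_def PiE_iff)
      have "restrict (\<lambda>i\<in>I. y (F i) i) (A j) = y j" if "j \<in> J" for j
        using yj[OF that] by (auto simp: A_def fun_eq_iff PiE_iff extensional_def)
      then show "(\<lambda>j\<in>J. restrict (\<lambda>i\<in>I. y (F i) i) (A j)) = y"
        using y by (auto simp: fun_eq_iff PiE_iff extensional_def)
    qed
    then show "pmf P x = (\<Sum>y\<in>(\<Pi>\<^sub>E j\<in>J. set_pmf (q' j)).
             (\<Prod>j\<in>J. pmf (q' j) (y j)) * (\<Prod>v\<in>V. pmf (K' v x y) (x v)))"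
      using latent_rep_pmf[OF rep x] by simp
  next
    fix v x y assume "v \<in> V"
    then show "set_pmf (K' v x y) \<subseteq> {..<c v}"
      unfolding K'_def by (rule latent_rep_set[OF rep])
  next
    fix v and x x' :: "_ \<Rightarrow> nat" and y y' :: "'j \<Rightarrow> 'i \<Rightarrow> 'b"
    assume "v \<in> V" "\<forall>u\<in>parents E {v}. x u = x' u" "\<forall>j\<in>J. v \<in> ch' j \<longrightarrow> y j = y' j"
    moreover from this F have "\<forall>i\<in>I. v \<in> ch i \<longrightarrow> y (F i) i = y' (F i) i" by (metis subsetD)
    ultimately show "K' v x y = K' v x' y'"
      unfolding K'_def by (intro latent_rep_local[OF rep]) auto
  next
    fix j assume "j \<in> J"
    show "finite (set_pmf (q' j))"
      unfolding set_q' using latent_rep_finite[OF rep] finA by (intro finite_PiE) (auto simp: A_def)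
  qed
  then show ?thesis by blast
qed

section \<open>Splitting one latent variable by Bayes' rule\<close>

text \<open>Only \<open>C\<close> and \<open>D\<close> see the value at \<open>B\<close>, so it
  suffices to preserve the joint weight of the values at \<open>C\<close> and of what
  \<open>D\<close> sees; prior times likelihood equals posterior times evidence. Index
  \<open>B\<close> keeps its distribution but now feeds \<open>C\<close> alone, and \<open>N\<close>
  carries the noise from which \<open>D\<close> computes its posterior sample.\<close>

lemma latent_rep_split:
  fixes V :: "'v set" and q :: "'i \<Rightarrow> nat pmf"
  assumes V: "finite V" and E: "E \<subseteq> V \<times> V" and I: "finite I"
    and rep: "latent_rep V E c I ch q K P"
    and B: "B \<in> I" "ch B = C \<union> D" and N: "N \<notin> I"
    and CD: "C \<subseteq> V" "D \<subseteq> V" "C \<inter> D = {}"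
    and par: "\<And>d. d \<in> D \<Longrightarrow> parents E C \<union> C \<subseteq> parents E {d}"
    and cov: "\<And>i. i \<in> I - {B} \<Longrightarrow> ch i \<inter> C \<noteq> {} \<Longrightarrow> D \<subseteq> ch i"
  shows "\<exists>(q' :: 'i \<Rightarrow> nat pmf) K'. latent_rep V E c (insert N I) (ch(B := C, N := D)) q' K' P"
proof -
  \<comment> \<open>\<open>W\<close> holds the other latent variables, \<open>Wc\<close> those
    acting on \<open>C\<close>, and \<open>L\<close> is the likelihood of the values at
    \<open>C\<close>. Hence \<open>g x w\<close> is the unnormalised posterior of the value at
    \<open>B\<close>.\<close>
  define W where "W = I - {B}"
  define Wc where "Wc = {i\<in>W. ch i \<inter> C \<noteq> {}}"
  define X where "X = parents E C \<union> C"
  define S where "S = set_pmf (q B)"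
  define L where "L = (\<lambda>x w b. \<Prod>v\<in>C. pmf (K v x (w(B := b))) (x v))"
  define g where "g = (\<lambda>x w b. pmf (q B) b * L x w b)"
  have I_eq: "I = insert B W" and BW: "B \<notin> W" and NW: "N \<notin> W" and NB: "N \<noteq> B"
    and finW: "finite W"
    using B N I by (auto simp: W_def)
  have finq: "finite (set_pmf (q i))" if "i \<in> I" for i
    using that by (rule latent_rep_finite[OF rep])
  have finS: "finite S" and S_ne: "S \<noteq> {}"
    using finq B by (auto simp: S_def set_pmf_not_empty)
  have XV: "X \<subseteq> V" using E CD by (auto simp: X_def parents_def)
  have K_set: "set_pmf (K v x y) \<subseteq> {..<c v}" if "v \<in> V" for v x y
    using that by (rule latent_rep_set[OF rep])
  have loc: "K v x y = K v x' y'"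
    if "v \<in> V" "\<And>u. u \<in> parents E {v} \<Longrightarrow> x u = x' u"
       "\<And>i. i \<in> I \<Longrightarrow> v \<in> ch i \<Longrightarrow> y i = y' i" for v x x' y y'
    using that by (rule latent_rep_local[OF rep])
  have finVs: "finite C" "finite D" "finite X"
    using V CD XV by (auto intro: finite_subset)

  \<comment> \<open>The posterior depends on \<open>X\<close> and \<open>Wc\<close> only.
    \<open>X\<close> includes \<open>C\<close> itself because the likelihood is taken at the values
    \<open>x v\<close>.\<close>
  have L_loc: "L (restrict x X) (restrict w Wc) b = L x w b" for x w b
  proof -
    have "K v (restrict x X) ((restrict w Wc)(B := b)) = K v x (w(B := b))" if "v \<in> C" for v
    proof (rule loc)
      show "v \<in> V" using that CD by auto
      show "restrict x X u = x u" if "u \<in> parents E {v}" for u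
        using that \<open>v \<in> C\<close> by (auto simp: X_def parents_def)
      show "((restrict w Wc)(B := b)) i = (w(B := b)) i" if "i \<in> I" "v \<in> ch i" for i
        using that \<open>v \<in> C\<close> by (auto simp: Wc_def W_def)
    qed
    then show ?thesis
      unfolding L_def by (intro prod.cong) (auto simp: X_def)
  qed

  \<comment> \<open>Written without division, the posterior also makes sense where the evidence is \<open>0\<close>.\<close>
  have "\<exists>p. set_pmf p \<subseteq> S \<and> (\<forall>b\<in>S. pmf p b * sum (g x w) S = g x w b)" for x w
  proof -
    have "0 \<le> g x w b" for b by (auto simp: g_def L_def intro!: mult_nonneg_nonneg prod_nonneg)
    then show ?thesis using normalised_pmf[OF finS S_ne] by metis
  qed
  then obtain post where post_set: "\<And>x w. set_pmf (post x w) \<subseteq> S"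
    and post: "\<And>x w b. b \<in> S \<Longrightarrow> pmf (post x w) b * sum (g x w) S = g x w b"
    by metis
  define Z where "Z = PiE X (\<lambda>v. {..<c v}) \<times> PiE Wc (\<lambda>i. set_pmf (q i))"
  have "finite Z"
    unfolding Z_def using finVs finW finq
    by (intro finite_cartesian_product finite_PiE) (auto simp: Wc_def W_def)
  then obtain m Q r where Q: "set_pmf Q = {..<m :: nat}"
    and r_set: "\<And>z e. z \<in> Z \<Longrightarrow> e < m \<Longrightarrow> r z e \<in> S"
    and r: "\<And>z. z \<in> Z \<Longrightarrow> map_pmf (r z) Q = post (fst z) (snd z)"
    using finite_kernel_function[of Z "\<lambda>z. post (fst z) (snd z)" S] post_set finS by metis
  define rr where "rr = (\<lambda>x w. r (restrict x X, restrict w Wc))"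
  define q' where "q' = q(N := Q)"
  \<comment> \<open>All nodes of \<open>D\<close> replace the value at \<open>B\<close> by the same
    response to the shared noise \<open>y N\<close>, so the dependence among them survives.\<close>
  define K' where "K' = (\<lambda>v x y. if v \<in> D then K v x (y(B := rr x y (y N))) else K v x y)"

  have "latent_rep V E c (insert N I) (ch(B := C, N := D)) q' K' P"
    unfolding latent_rep_def
  proof (intro conjI ballI allI impI)
    fix i assume "i \<in> insert N I"
    then show "finite (set_pmf (q' i))" using Q finq by (auto simp: q'_def)
  next
    fix v x y assume "v \<in> V"
    then show "set_pmf (K' v x y) \<subseteq> {..<c v}" using K_set by (auto simp: K'_def)
  next
    fix v and x x' :: "_ \<Rightarrow> nat" and y y' :: "_ \<Rightarrow> nat"
    assume v: "v \<in> V" and x: "\<forall>u\<in>parents E {v}. x u = x' u"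
      and y: "\<forall>i\<in>insert N I. v \<in> (ch(B := C, N := D)) i \<longrightarrow> y i = y' i"
    have yI: "y i = y' i" if "i \<in> I" "i \<noteq> B" "v \<in> ch i" for i
    proof -
      have "i \<noteq> N" using that N by blast
      then show ?thesis using bspec[OF y, of i] that by simp
    qed
    have yB: "y B = y' B" if "v \<in> C"
      using bspec[OF y, of B] that B NB by simp
    have yN: "y N = y' N" if "v \<in> D"
      using bspec[OF y, of N] that by simp
    show "K' v x y = K' v x' y'"
    proof (cases "v \<in> D")
      case True
      \<comment> \<open>A node of \<open>D\<close> sees all of \<open>X\<close> by
        \<open>par\<close> and all of \<open>Wc\<close> by \<open>cov\<close>, so it can evaluate
        the response.\<close>
      have "restrict x X = restrict x' X"
        using x par[OF True] unfolding X_def by (intro restrict_ext) blast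
      moreover have "restrict y Wc = restrict y' Wc"
      proof (rule restrict_ext)
        fix i assume "i \<in> Wc"
        then have "i \<in> I" "i \<noteq> B" "D \<subseteq> ch i" using cov by (auto simp: Wc_def W_def)
        then show "y i = y' i" using yI True by auto
      qed
      ultimately have "rr x y (y N) = rr x' y' (y' N)" using yN True by (simp add: rr_def)
      then have "K v x (y(B := rr x y (y N))) = K v x' (y'(B := rr x' y' (y' N)))"
        using x yI by (intro loc v) auto
      then show ?thesis using True by (simp add: K'_def)
    next
      case False
      have "K v x y = K v x' y'"
      proof (rule loc[OF v])
        show "x u = x' u" if "u \<in> parents E {v}" for u using x that by blast
        \<comment> \<open>A child of \<open>B\<close> outside \<open>D\<close> lies in
          \<open>C\<close>, which still has access to index \<open>B\<close>.\<close>
        show "y i = y' i" if "i \<in> I" "v \<in> ch i" for i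
          using yI yB that B False by (cases "i = B") auto
      qed
      then show ?thesis using False by (simp add: K'_def)
    qed
  next
    fix x assume x: "x \<in> (\<Pi>\<^sub>E v\<in>V. {..<c v})"
    \<comment> \<open>Besides \<open>L\<close>, the summand consists of the weight \<alpha> of the
      other latent variables, the likelihood \<open>M\<close> of the values at \<open>D\<close>, and
      a rest \<open>R\<close> free of the value at \<open>B\<close>.\<close>
    define \<alpha> where "\<alpha> = (\<lambda>w. \<Prod>i\<in>W. pmf (q i) (w i))"
    define M where "M = (\<lambda>w b. \<Prod>v\<in>D. pmf (K v x (w(B := b))) (x v))"
    define R where "R = (\<lambda>w. \<Prod>v\<in>V - C - D. pmf (K v x w) (x v))"
    let ?PW = "PiE W (\<lambda>i. set_pmf (q i))"
    have prodV: "(\<Prod>v\<in>V. h v) = (\<Prod>v\<in>C. h v) * (\<Prod>v\<in>D. h v) * (\<Prod>v\<in>V - C - D. h v)"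
      for h :: "'v \<Rightarrow> real"
    proof -
      have "(\<Prod>v\<in>V. h v) = (\<Prod>v\<in>V - C. h v) * (\<Prod>v\<in>C. h v)"
        by (rule prod.subset_diff[OF CD(1) V])
      also have "(\<Prod>v\<in>V - C. h v) = (\<Prod>v\<in>V - C - D. h v) * (\<Prod>v\<in>D. h v)"
        using CD V by (intro prod.subset_diff) auto
      finally show ?thesis by (simp add: mult_ac)
    qed
    have sumI: "(\<Sum>y\<in>(\<Pi>\<^sub>E i\<in>I. set_pmf (q i)). h y) = (\<Sum>b\<in>S. \<Sum>w\<in>?PW. h (w(B := b)))"
      for h :: "('i \<Rightarrow> nat) \<Rightarrow> real"
    proof -
      have "finite (set_pmf (q i))" if "i \<in> W" for i using that finq I_eq by blast
      then show ?thesis unfolding I_eq S_def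
        using finW BW finS by (intro sum_PiE_insert) (simp_all add: S_def)
    qed
    have prodI: "(\<Prod>i\<in>I. pmf (q i) ((w(B := b)) i)) = pmf (q B) b * \<alpha> w" for w b
      unfolding I_eq \<alpha>_def using finW BW by (subst prod.insert) (auto intro!: prod.cong)
    have prodI': "(\<Prod>i\<in>insert N I. pmf (q' i) ((w(B := b, N := e)) i)) =
        pmf Q e * (pmf (q B) b * \<alpha> w)" for w b e
    proof -
      have "(\<Prod>i\<in>I. pmf (q' i) ((w(B := b, N := e)) i)) = (\<Prod>i\<in>I. pmf (q i) ((w(B := b)) i))"
        using N by (intro prod.cong) (auto simp: q'_def)
      then show ?thesis using I N prodI by (simp add: q'_def)
    qed
    have K_R: "K v x (w(B := b)) = K v x w" if "v \<in> V - C - D" for v w b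
      using that B by (intro loc) auto
    have like: "(\<Prod>v\<in>V. pmf (K v x (w(B := b))) (x v)) = L x w b * M w b * R w" for w b
      unfolding prodV L_def M_def R_def using K_R by simp
    \<comment> \<open>The value \<open>b\<close> has no influence: it is overwritten, and since
      neither \<open>B\<close> nor \<open>N\<close> is in \<open>Wc\<close>, the response depends on
      \<open>w\<close> and \<open>e\<close> alone.\<close>
    have K'D: "K' v x (w(B := b, N := e)) = K v x (w(B := rr x w e))" if "v \<in> D" for v w b e
    proof -
      have "restrict (w(B := b, N := e)) Wc = restrict w Wc"
        using NW BW by (auto simp: Wc_def restrict_def)
      then have "rr x (w(B := b, N := e)) e = rr x w e" by (simp add: rr_def)
      moreover have "K v x ((w(B := b, N := e))(B := rr x w e)) = K v x (w(B := rr x w e))"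
        using that CD N by (intro loc) auto
      ultimately show ?thesis using that by (simp add: K'_def)
    qed
    have K'C: "K' v x (w(B := b, N := e)) = K v x (w(B := b))" if "v \<in> V - D" for v w b e
      using that N by (auto simp: K'_def intro!: loc)
    have like': "(\<Prod>v\<in>V. pmf (K' v x (w(B := b, N := e))) (x v)) =
        L x w b * M w (rr x w e) * R w" for w b e
    proof -
      have "(\<Prod>v\<in>C. pmf (K' v x (w(B := b, N := e))) (x v)) = L x w b"
      proof -
        have "v \<in> V - D" if "v \<in> C" for v using that CD by blast
        then show ?thesis unfolding L_def by (intro prod.cong refl) (simp only: K'C)
      qed
      moreover have "(\<Prod>v\<in>V - C - D. pmf (K' v x (w(B := b, N := e))) (x v)) = R w"
      proof -
        have "K' v x (w(B := b, N := e)) = K v x w" if "v \<in> V - C - D" for v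
          using that K'C[of v] K_R[of v] by simp
        then show ?thesis unfolding R_def by (intro prod.cong refl) simp
      qed
      ultimately show ?thesis unfolding prodV M_def by (simp add: K'D)
    qed
    \<comment> \<open>Averaging over the noise is averaging over the posterior; the evidence
      \<open>sum (g x w) S\<close> then turns the posterior back into the joint weight.\<close>
    have resp: "(\<Sum>e<m. pmf Q e * M w (rr x w e)) * sum (g x w) S = (\<Sum>b\<in>S. g x w b * M w b)"
      if w: "w \<in> ?PW" for w
    proof -
      let ?z = "(restrict x X, restrict w Wc)"
      have z: "?z \<in> Z" using x w XV by (auto simp: Z_def Wc_def)
      have g_loc: "g (restrict x X) (restrict w Wc) = g x w"
        by (simp add: g_def L_loc fun_eq_iff)
      have "(\<Sum>e<m. pmf Q e * M w (rr x w e)) = (LINT e|measure_pmf Q. M w (r ?z e))"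
        using Q by (subst integral_measure_pmf_real[of "{..<m}"]) (auto simp: rr_def mult_ac)
      also have "\<dots> = (LINT b|measure_pmf (map_pmf (r ?z) Q). M w b)" by simp
      also have "\<dots> = (\<Sum>b\<in>S. M w b * pmf (post (fst ?z) (snd ?z)) b)"
        unfolding r[OF z] using finS post_set by (intro integral_measure_pmf_real) blast+
      finally have "(\<Sum>e<m. pmf Q e * M w (rr x w e)) * sum (g x w) S =
          (\<Sum>b\<in>S. M w b * (pmf (post (fst ?z) (snd ?z)) b * sum (g (fst ?z) (snd ?z)) S))"
        by (simp add: sum_distrib_right g_loc mult.assoc)
      also have "\<dots> = (\<Sum>b\<in>S. M w b * g (fst ?z) (snd ?z) b)"
        by (intro sum.cong refl) (simp only: post)
      finally show ?thesis by (simp add: g_loc mult.commute)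
    qed
    have "pmf P x = (\<Sum>y\<in>(\<Pi>\<^sub>E i\<in>I. set_pmf (q i)).
                     (\<Prod>i\<in>I. pmf (q i) (y i)) * (\<Prod>v\<in>V. pmf (K v x y) (x v)))"
      using x by (rule latent_rep_pmf[OF rep])
    also have "\<dots> = (\<Sum>b\<in>S. \<Sum>w\<in>?PW. pmf (q B) b * \<alpha> w * (L x w b * M w b * R w))"
      unfolding sumI prodI like ..
    also have "\<dots> = (\<Sum>w\<in>?PW. \<alpha> w * R w * (\<Sum>b\<in>S. g x w b * M w b))"
      by (subst sum.swap) (simp add: sum_distrib_left g_def mult_ac)
    also have "\<dots> = (\<Sum>w\<in>?PW. \<alpha> w * R w *
        ((\<Sum>e<m. pmf Q e * M w (rr x w e)) * sum (g x w) S))"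
      by (intro sum.cong refl) (simp add: resp)
    \<comment> \<open>Expanding the evidence over \<open>b\<close> supplies the copy for
      \<open>C\<close>, while \<open>e\<close> supplies the copy for \<open>D\<close>.\<close>
    also have "\<dots> = (\<Sum>w\<in>?PW. \<Sum>e<m. \<Sum>b\<in>S.
        pmf Q e * (pmf (q B) b * \<alpha> w) * (L x w b * M w (rr x w e) * R w))"
      by (simp add: sum_product sum_distrib_left g_def mult_ac)
    also have "\<dots> = (\<Sum>e<m. \<Sum>w\<in>?PW. \<Sum>b\<in>S.
        pmf Q e * (pmf (q B) b * \<alpha> w) * (L x w b * M w (rr x w e) * R w))"
      by (rule sum.swap)
    also have "\<dots> = (\<Sum>e<m. \<Sum>b\<in>S. \<Sum>w\<in>?PW.
        pmf Q e * (pmf (q B) b * \<alpha> w) * (L x w b * M w (rr x w e) * R w))"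
      by (intro sum.cong refl) (rule sum.swap)
    also have "\<dots> = (\<Sum>e<m. \<Sum>y\<in>(\<Pi>\<^sub>E i\<in>I. set_pmf (q i)).
        (\<Prod>i\<in>insert N I. pmf (q' i) ((y(N := e)) i)) * (\<Prod>v\<in>V. pmf (K' v x (y(N := e))) (x v)))"
      unfolding sumI prodI' like' ..
    also have "\<dots> = (\<Sum>e\<in>set_pmf (q' N). \<Sum>y\<in>(\<Pi>\<^sub>E i\<in>I. set_pmf (q' i)).
        (\<Prod>i\<in>insert N I. pmf (q' i) ((y(N := e)) i)) * (\<Prod>v\<in>V. pmf (K' v x (y(N := e))) (x v)))"
    proof -
      have "(\<Pi>\<^sub>E i\<in>I. set_pmf (q' i)) = (\<Pi>\<^sub>E i\<in>I. set_pmf (q i))"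
        using N by (intro PiE_cong) (auto simp: q'_def)
      moreover have "set_pmf (q' N) = {..<m}" by (simp add: q'_def Q)
      ultimately show ?thesis by simp
    qed
    also have "\<dots> = (\<Sum>y\<in>(\<Pi>\<^sub>E i\<in>insert N I. set_pmf (q' i)).
        (\<Prod>i\<in>insert N I. pmf (q' i) (y i)) * (\<Prod>v\<in>V. pmf (K' v x y) (x v)))"
      using I N finq Q by (intro sum_PiE_insert[symmetric]) (auto simp: q'_def)
    finally show "pmf P x = (\<Sum>y\<in>(\<Pi>\<^sub>E i\<in>insert N I. set_pmf (q' i)).
        (\<Prod>i\<in>insert N I. pmf (q' i) (y i)) * (\<Prod>v\<in>V. pmf (K' v x y) (x v)))" .
  qed
  then show ?thesis by blast
qed

section \<open>Translation to and from the structural model of the canonical pDAG\<close>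

lemma parents_can:
  "parents (edges (can G)) {Inl v} = Inl ` parents (directed G) {v} \<union> Inr ` {A \<in> facets G. v \<in> A}"
  "parents (edges (can G)) {Inr A} = {}"
  by (auto simp: parents_def can_def)

lemma restrict_parents_can:
  assumes "is_mdag G" "x \<in> (\<Pi>\<^sub>E v\<in>nodes G. {..<c v})" "y \<in> (\<Pi>\<^sub>E l\<in>facets G. {..<k l})"
  shows "restrict (case_sum x y) (parents (edges (can G)) {Inl v}) \<in>
    (\<Pi>\<^sub>E b\<in>parents (edges (can G)) {Inl v}. {..<case_sum c k b})"
proof -
  have "parents (directed G) {v} \<subseteq> nodes G"
    using assms(1) by (auto simp: is_mdag_def parents_def)
  then show ?thesis
    using assms(2,3) unfolding parents_can restrict_PiE_iff by auto
qed

text \<open>Each node has its own error variable, so the sum of products factors into one sum per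
  node.\<close>

lemma sum_errors:
  fixes Q :: "'a \<Rightarrow> nat pmf"
  assumes "finite N" "\<And>a. a \<in> N \<Longrightarrow> set_pmf (Q a) \<subseteq> {..<m a}"
  shows "(\<Sum>e\<in>(\<Pi>\<^sub>E a\<in>N. {..<m a}). \<Prod>a\<in>N. of_bool (s a = f a (e a)) * pmf (Q a) (e a)) =
         (\<Prod>a\<in>N. pmf (map_pmf (f a) (Q a)) (s a))"
proof -
  have "(\<Sum>e\<in>(\<Pi>\<^sub>E a\<in>N. {..<m a}). \<Prod>a\<in>N. of_bool (s a = f a (e a)) * pmf (Q a) (e a)) =
        (\<Prod>a\<in>N. \<Sum>e<m a. of_bool (s a = f a e) * pmf (Q a) e)"
    using assms by (subst prod_sum_PiE) auto
  also have "\<dots> = (\<Prod>a\<in>N. pmf (map_pmf (f a) (Q a)) (s a))"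
    using assms by (intro prod.cong refl pmf_map_sum_nat[symmetric]) auto
  finally show ?thesis .
qed

lemma facets_subset: "A \<in> facets G \<Longrightarrow> A \<in> faces G"
  by (simp add: facets_def)

lemma facets_maximal: "A \<in> facets G \<Longrightarrow> A' \<in> faces G \<Longrightarrow> A \<subseteq> A' \<Longrightarrow> A' = A"
  by (simp add: facets_def)

lemma face_subset_facet:
  assumes "is_mdag G" "A \<in> faces G"
  shows "\<exists>F\<in>facets G. A \<subseteq> F"
proof -
  have "finite (faces G)"
    using assms by (auto simp: is_mdag_def intro: finite_subset[of _ "Pow (nodes G)"])
  from finite_has_maximal2[OF this assms(2)] show ?thesis
    by (auto simp: facets_def)
qed

lemma finite_facets: "is_mdag G \<Longrightarrow> finite (facets G)"
  by (rule finite_subset[of _ "Pow (nodes G)"]) (auto simp: is_mdag_def facets_def)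

lemma mdag_model_imp_latent_rep:
  fixes G :: "'v mdag"
  assumes G: "is_mdag G" and c: "\<And>v. v \<in> nodes G \<Longrightarrow> 0 < c v" and P: "P \<in> mdag_model G c"
  shows "\<exists>(q :: 'v set \<Rightarrow> nat pmf) K.
    latent_rep (nodes G) (directed G) c (facets G) (\<lambda>A. A) q K P"
proof -
  let ?par = "\<lambda>a. parents (edges (can G)) {a}"
  let ?N = "nodes G <+> facets G"
  have finV: "finite (nodes G)" and finL: "finite (facets G)"
    using G finite_facets by (auto simp: is_mdag_def)
  have sel: "visible (can G) = nodes G" "latent (can G) = facets G" "pnodes (can G) = ?N"
    by (auto simp: can_def pnodes_def)
  have "\<exists>k (m :: _ \<Rightarrow> nat) Q f. (\<forall>a\<in>?N. set_pmf (Q a) \<subseteq> {..<m a}) \<and>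
      (\<forall>a\<in>?N. \<forall>z\<in>(\<Pi>\<^sub>E b\<in>?par a. {..<case_sum c k b}). \<forall>e<m a. f a z e < case_sum c k a) \<and>
      (\<forall>x\<in>(\<Pi>\<^sub>E v\<in>nodes G. {..<c v}). pmf P x =
         (\<Sum>y\<in>(\<Pi>\<^sub>E l\<in>facets G. {..<k l}). \<Sum>e\<in>(\<Pi>\<^sub>E a\<in>?N. {..<m a}). \<Prod>a\<in>?N.
            of_bool (case_sum x y a = f a (restrict (case_sum x y) (?par a)) (e a)) * pmf (Q a) (e a)))"
    using P unfolding mdag_model_def pdag_model_def sel mem_Collect_eq by (rule conjunct2)
  then obtain k and m :: "_ \<Rightarrow> nat" and Q f where
    "\<forall>a\<in>?N. set_pmf (Q a) \<subseteq> {..<m a}"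
    "\<forall>a\<in>?N. \<forall>z\<in>(\<Pi>\<^sub>E b\<in>?par a. {..<case_sum c k b}). \<forall>e<m a. f a z e < case_sum c k a"
    "\<forall>x\<in>(\<Pi>\<^sub>E v\<in>nodes G. {..<c v}). pmf P x =
       (\<Sum>y\<in>(\<Pi>\<^sub>E l\<in>facets G. {..<k l}). \<Sum>e\<in>(\<Pi>\<^sub>E a\<in>?N. {..<m a}). \<Prod>a\<in>?N.
          of_bool (case_sum x y a = f a (restrict (case_sum x y) (?par a)) (e a)) * pmf (Q a) (e a))"
    by (elim exE conjE)
  note Q = this(1)[rule_format] and f = this(2)[rule_format] and eq = this(3)[rule_format]
  \<comment> \<open>A latent node has no parents in \<open>can G\<close>, so its function is only
    applied to the empty assignment \<open>\<lambda>_. undefined\<close>.\<close>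
  define q where "q = (\<lambda>A. map_pmf (f (Inr A) (\<lambda>_. undefined)) (Q (Inr A)))"
  \<comment> \<open>Kernels are constrained at all assignments, but \<open>f\<close> is controlled
    only at arguments in range. The default \<open>return_pmf 0\<close> fills the gap and is legal
    because \<open>0 < c v\<close>.\<close>
  define K where "K = (\<lambda>v x y. let z = restrict (case_sum x y) (?par (Inl v)) in
    if z \<in> (\<Pi>\<^sub>E b\<in>?par (Inl v). {..<case_sum c k b}) then map_pmf (f (Inl v) z) (Q (Inl v))
    else return_pmf 0)"
  have q_set: "set_pmf (q A) \<subseteq> {..<k A}" if "A \<in> facets G" for A
    using Q[of "Inr A"] f[of "Inr A" "\<lambda>_. undefined"] that by (force simp: q_def parents_can)
  have "latent_rep (nodes G) (directed G) c (facets G) (\<lambda>A. A) q K P"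
    unfolding latent_rep_def
  proof (intro conjI ballI allI impI)
    fix A assume "A \<in> facets G"
    then show "finite (set_pmf (q A))" using q_set finite_subset by blast
  next
    fix v and x and y :: "'v set \<Rightarrow> nat" assume v: "v \<in> nodes G"
    let ?z = "restrict (case_sum x y) (?par (Inl v))"
    have v': "Inl v \<in> ?N" using v by (rule InlI)
    show "set_pmf (K v x y) \<subseteq> {..<c v}"
    proof (cases "?z \<in> (\<Pi>\<^sub>E b\<in>?par (Inl v). {..<case_sum c k b})")
      case True
      have "f (Inl v) ?z e < c v" if "e \<in> set_pmf (Q (Inl v))" for e
        using f[OF v' True, of e] Q[OF v'] that by auto
      then show ?thesis using True by (auto simp: K_def Let_def)
    next
      case False
      then show ?thesis using c[OF v] by (simp add: K_def Let_def)
    qed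
  next
    fix v and x x' :: "_ \<Rightarrow> nat" and y y' :: "'v set \<Rightarrow> nat"
    assume "\<forall>u\<in>parents (directed G) {v}. x u = x' u" "\<forall>A\<in>facets G. v \<in> A \<longrightarrow> y A = y' A"
    then have "restrict (case_sum x y) (?par (Inl v)) = restrict (case_sum x' y') (?par (Inl v))"
      by (intro restrict_ext) (auto simp: parents_can)
    then show "K v x y = K v x' y'" by (simp only: K_def)
  next
    fix x assume x: "x \<in> (\<Pi>\<^sub>E v\<in>nodes G. {..<c v})"
    have "pmf P x = (\<Sum>y\<in>(\<Pi>\<^sub>E l\<in>facets G. {..<k l}). \<Prod>a\<in>?N.
        pmf (map_pmf (f a (restrict (case_sum x y) (?par a))) (Q a)) (case_sum x y a))"
      unfolding eq[OF x] using finV finL Q by (intro sum.cong refl sum_errors) auto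
    also have "\<dots> = (\<Sum>y\<in>(\<Pi>\<^sub>E l\<in>facets G. {..<k l}).
        (\<Prod>A\<in>facets G. pmf (q A) (y A)) * (\<Prod>v\<in>nodes G. pmf (K v x y) (x v)))"
    proof (intro sum.cong refl)
      fix y assume y: "y \<in> (\<Pi>\<^sub>E l\<in>facets G. {..<k l})"
      have "K v x y = map_pmf (f (Inl v) (restrict (case_sum x y) (?par (Inl v)))) (Q (Inl v))" for v
        using restrict_parents_can[OF G x y] by (simp only: K_def Let_def if_True)
      then show "(\<Prod>a\<in>?N. pmf (map_pmf (f a (restrict (case_sum x y) (?par a))) (Q a)) (case_sum x y a)) =
          (\<Prod>A\<in>facets G. pmf (q A) (y A)) * (\<Prod>v\<in>nodes G. pmf (K v x y) (x v))"
        by (simp add: prod.Plus finV finL q_def parents_can(2) restrict_def mult.commute)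
    qed
    also have "\<dots> = (\<Sum>y\<in>(\<Pi>\<^sub>E l\<in>facets G. set_pmf (q l)).
        (\<Prod>A\<in>facets G. pmf (q A) (y A)) * (\<Prod>v\<in>nodes G. pmf (K v x y) (x v)))"
      using finL q_set by (intro sum_PiE_set_pmf) auto
    finally show "pmf P x = (\<Sum>y\<in>(\<Pi>\<^sub>E l\<in>facets G. set_pmf (q l)).
        (\<Prod>A\<in>facets G. pmf (q A) (y A)) * (\<Prod>v\<in>nodes G. pmf (K v x y) (x v)))" .
  qed
  then show ?thesis by blast
qed

text \<open>A kernel on finitely many parent assignments is realised by one error variable coding a
  random response function. A latent node simply copies its error variable, which is given the
  distribution \<open>q A\<close>.\<close>

lemma latent_rep_facets_imp_mdag_model:
  fixes G :: "'v mdag" and q :: "'v set \<Rightarrow> nat pmf"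
  assumes G: "is_mdag G" and P: "set_pmf P \<subseteq> (\<Pi>\<^sub>E v\<in>nodes G. {..<c v})"
    and rep: "latent_rep (nodes G) (directed G) c (facets G) (\<lambda>A. A) q K P"
  shows "P \<in> mdag_model G c"
proof -
  let ?par = "\<lambda>a. parents (edges (can G)) {a}"
  let ?N = "nodes G <+> facets G"
  have finV: "finite (nodes G)" and finL: "finite (facets G)"
    and dir: "directed G \<subseteq> nodes G \<times> nodes G"
    using G finite_facets by (auto simp: is_mdag_def)
  have sel: "visible (can G) = nodes G" "latent (can G) = facets G" "pnodes (can G) = ?N"
    by (auto simp: can_def pnodes_def)
  define k where "k = (\<lambda>A. Suc (Max (set_pmf (q A))))"
  have q_set: "set_pmf (q A) \<subseteq> {..<k A}" if "A \<in> facets G" for A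
    using latent_rep_finite[OF rep that] by (auto simp: k_def less_Suc_eq_le)
  have loc: "K v x y = K v x' y'"
    if "v \<in> nodes G" "\<And>u. u \<in> parents (directed G) {v} \<Longrightarrow> x u = x' u"
       "\<And>A. A \<in> facets G \<Longrightarrow> v \<in> A \<Longrightarrow> y A = y' A" for v x x' y y'
    using that by (rule latent_rep_local[OF rep])
  define Z where "Z = (\<lambda>v. \<Pi>\<^sub>E b\<in>?par (Inl v). {..<case_sum c k b})"
  have "finite (parents (directed G) {v})" for v
    using dir finV by (auto simp: parents_def intro: finite_subset)
  then have finZ: "finite (Z v)" for v
    unfolding Z_def using finL by (intro finite_PiE) (auto simp: parents_can split: sum.split)
  \<comment> \<open>The triple packs size, distribution and function of one node, so that a single
    choice over the nodes suffices; \<open>z \<circ> Inl\<close> and \<open>z \<circ> Inr\<close>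
    are the visible and latent parts of \<open>z\<close>.\<close>
  have "\<forall>v\<in>nodes G. \<exists>t :: nat \<times> nat pmf \<times> (('v + 'v set \<Rightarrow> nat) \<Rightarrow> nat \<Rightarrow> nat).
      set_pmf (fst (snd t)) = {..<fst t} \<and>
      (\<forall>z\<in>Z v. (\<forall>e<fst t. snd (snd t) z e < c v) \<and>
         map_pmf (snd (snd t) z) (fst (snd t)) = K v (z \<circ> Inl) (z \<circ> Inr))"
  proof
    fix v assume "v \<in> nodes G"
    then have K: "set_pmf (K v (z \<circ> Inl) (z \<circ> Inr)) \<subseteq> {..<c v}" for z
      by (rule latent_rep_set[OF rep])
    show "\<exists>t :: nat \<times> nat pmf \<times> (('v + 'v set \<Rightarrow> nat) \<Rightarrow> nat \<Rightarrow> nat).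
        set_pmf (fst (snd t)) = {..<fst t} \<and>
        (\<forall>z\<in>Z v. (\<forall>e<fst t. snd (snd t) z e < c v) \<and>
           map_pmf (snd (snd t) z) (fst (snd t)) = K v (z \<circ> Inl) (z \<circ> Inr))"
    proof (rule finite_kernel_function[where Z = "Z v" and S = "{..<c v}" and
          K = "\<lambda>z. K v (z \<circ> Inl) (z \<circ> Inr)", OF finZ K finite_lessThan])
      fix Q and m :: nat and f
      assume "set_pmf Q = {..<m}" "\<And>z e. z \<in> Z v \<Longrightarrow> e < m \<Longrightarrow> f z e \<in> {..<c v}"
        "\<And>z. z \<in> Z v \<Longrightarrow> map_pmf (f z) Q = K v (z \<circ> Inl) (z \<circ> Inr)"
      then show ?thesis
        by (intro exI[of _ "(m, Q, f)"]) auto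
    qed
  qed
  from bchoice[OF this] obtain t :: "'v \<Rightarrow> nat \<times> nat pmf \<times> (('v + 'v set \<Rightarrow> nat) \<Rightarrow> nat \<Rightarrow> nat)"
    where t: "\<forall>v\<in>nodes G. set_pmf (fst (snd (t v))) = {..<fst (t v)} \<and>
      (\<forall>z\<in>Z v. (\<forall>e<fst (t v). snd (snd (t v)) z e < c v) \<and>
         map_pmf (snd (snd (t v)) z) (fst (snd (t v))) = K v (z \<circ> Inl) (z \<circ> Inr))"
    by blast
  define m where "m = (\<lambda>v. fst (t v))"
  define Q where "Q = (\<lambda>v. fst (snd (t v)))"
  define f where "f = (\<lambda>v. snd (snd (t v)))"
  have Q: "set_pmf (Q v) = {..<m v}" if "v \<in> nodes G" for v
    using t that by (simp add: Q_def m_def)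
  have f: "f v z e < c v" if "v \<in> nodes G" "z \<in> Z v" "e < m v" for v z e
    using t that by (simp add: f_def m_def)
  have fQ: "map_pmf (f v z) (Q v) = K v (z \<circ> Inl) (z \<circ> Inr)"
    if "v \<in> nodes G" "z \<in> Z v" for v z
    using t that by (simp add: f_def Q_def)
  define f' where "f' = case_sum f (\<lambda>(_ :: 'v set) _ e. e)"
  define Q' where "Q' = case_sum Q q"
  define m' where "m' = case_sum m k"
  have Q': "set_pmf (Q' a) \<subseteq> {..<m' a}" if "a \<in> ?N" for a
    using that Q q_set[THEN subsetD] by (auto simp: Q'_def m'_def)
  have f': "f' a z e < case_sum c k a"
    if "a \<in> ?N" "z \<in> (\<Pi>\<^sub>E b\<in>?par a. {..<case_sum c k b})" "e < m' a" for a z e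
    using that f by (auto simp: f'_def m'_def Z_def)
  have eq: "pmf P x = (\<Sum>y\<in>(\<Pi>\<^sub>E l\<in>facets G. {..<k l}). \<Sum>e\<in>(\<Pi>\<^sub>E a\<in>?N. {..<m' a}). \<Prod>a\<in>?N.
      of_bool (case_sum x y a = f' a (restrict (case_sum x y) (?par a)) (e a)) * pmf (Q' a) (e a))"
    if x: "x \<in> (\<Pi>\<^sub>E v\<in>nodes G. {..<c v})" for x
  proof -
    have "pmf P x = (\<Sum>y\<in>(\<Pi>\<^sub>E l\<in>facets G. set_pmf (q l)).
        (\<Prod>A\<in>facets G. pmf (q A) (y A)) * (\<Prod>v\<in>nodes G. pmf (K v x y) (x v)))"
      using x by (rule latent_rep_pmf[OF rep])
    also have "\<dots> = (\<Sum>y\<in>(\<Pi>\<^sub>E l\<in>facets G. {..<k l}).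
        (\<Prod>A\<in>facets G. pmf (q A) (y A)) * (\<Prod>v\<in>nodes G. pmf (K v x y) (x v)))"
      using finL q_set by (intro sum_PiE_set_pmf[symmetric]) auto
    also have "\<dots> = (\<Sum>y\<in>(\<Pi>\<^sub>E l\<in>facets G. {..<k l}). \<Prod>a\<in>?N.
        pmf (map_pmf (f' a (restrict (case_sum x y) (?par a))) (Q' a)) (case_sum x y a))"
    proof (intro sum.cong refl)
      fix y assume y: "y \<in> (\<Pi>\<^sub>E l\<in>facets G. {..<k l})"
      have "map_pmf (f v (restrict (case_sum x y) (?par (Inl v)))) (Q v) = K v x y"
        if v: "v \<in> nodes G" for v
      proof -
        let ?z = "restrict (case_sum x y) (?par (Inl v))"
        have "?z \<in> Z v"
          using restrict_parents_can[OF G x y] by (simp only: Z_def)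
        then have "map_pmf (f v ?z) (Q v) = K v (?z \<circ> Inl) (?z \<circ> Inr)" using v fQ by blast
        \<comment> \<open>The restricted assignment is \<open>undefined\<close> away from the
          parents of \<open>v\<close>, where locality makes the kernel blind.\<close>
        also have "\<dots> = K v x y" by (intro loc v) (auto simp: parents_can)
        finally show ?thesis .
      qed
      then show "(\<Prod>A\<in>facets G. pmf (q A) (y A)) * (\<Prod>v\<in>nodes G. pmf (K v x y) (x v)) =
          (\<Prod>a\<in>?N. pmf (map_pmf (f' a (restrict (case_sum x y) (?par a))) (Q' a)) (case_sum x y a))"
        by (simp add: prod.Plus finV finL f'_def Q'_def mult.commute)
    qed
    also have "\<dots> = (\<Sum>y\<in>(\<Pi>\<^sub>E l\<in>facets G. {..<k l}). \<Sum>e\<in>(\<Pi>\<^sub>E a\<in>?N. {..<m' a}). \<Prod>a\<in>?N.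
      of_bool (case_sum x y a = f' a (restrict (case_sum x y) (?par a)) (e a)) * pmf (Q' a) (e a))"
      using finV finL Q' by (intro sum.cong refl sum_errors[symmetric]) auto
    finally show ?thesis .
  qed
  show ?thesis
    unfolding mdag_model_def pdag_model_def sel mem_Collect_eq
    by (intro conjI exI[of _ k] exI[of _ m'] exI[of _ Q'] exI[of _ f'] ballI allI impI P Q' f' eq)
qed

text \<open>Each latent variable is absorbed into a facet containing its children, and the merged
  values are then renumbered. Thus faces may index latent variables as well as facets.\<close>

lemma latent_rep_imp_mdag_model:
  fixes G :: "'v mdag" and q :: "'i \<Rightarrow> 'b pmf"
  assumes G: "is_mdag G" and P: "set_pmf P \<subseteq> (\<Pi>\<^sub>E v\<in>nodes G. {..<c v})"
    and I: "finite I" "\<And>i. i \<in> I \<Longrightarrow> ch i \<in> faces G"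
    and rep: "latent_rep (nodes G) (directed G) c I ch q K P"
  shows "P \<in> mdag_model G c"
proof -
  have "\<forall>i\<in>I. \<exists>F. F \<in> facets G \<and> ch i \<subseteq> F"
    using face_subset_facet[OF G] I(2) by blast
  then obtain F where F: "\<forall>i\<in>I. F i \<in> facets G \<and> ch i \<subseteq> F i"
    by metis
  obtain q1 :: "'v set \<Rightarrow> ('i \<Rightarrow> 'b) pmf" and K1
    where "latent_rep (nodes G) (directed G) c (facets G) (\<lambda>A. A) q1 K1 P"
    using latent_rep_merge[OF I(1) finite_facets[OF G] rep, of F "\<lambda>A. A"] F by blast
  then obtain q2 :: "'v set \<Rightarrow> nat pmf" and K2
    where "latent_rep (nodes G) (directed G) c (facets G) (\<lambda>A. A) q2 K2 P"
    using latent_rep_encode by blast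
  then show ?thesis by (rule latent_rep_facets_imp_mdag_model[OF G P])
qed

lemma set_pmf_mdag_model:
  "P \<in> mdag_model G c \<Longrightarrow> set_pmf P \<subseteq> (\<Pi>\<^sub>E v\<in>nodes G. {..<c v})"
  unfolding mdag_model_def pdag_model_def can_def by auto

section \<open>Adding the face \<open>C \<union> D\<close>\<close>

theorem proposition7:
  fixes G :: "'v mdag" and C D :: "'v set"
  assumes "is_mdag G"
    and "C \<in> faces G" and "D \<in> faces G" and "C \<inter> D = {}"
    and "\<forall>d\<in>D. parents (directed G) C \<union> C \<subseteq> parents (directed G) {d}"
    and "\<forall>B'\<in>facets G. \<not> B' \<subseteq> C \<longrightarrow> (\<exists>c\<in>C. c \<in> B') \<longrightarrow> D \<subset> B'"
  shows "obs_dominates G (add_face G (C \<union> D)) \<and> obs_equivalent G (add_face G (C \<union> D))"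
proof -
  define B where "B = C \<union> D"
  let ?G' = "add_face G B"
  have fc: "\<And>A A'. A \<in> faces G \<Longrightarrow> A' \<subseteq> A \<Longrightarrow> A' \<in> faces G"
    and CN: "C \<subseteq> nodes G" and DN: "D \<subseteq> nodes G"
    and V: "finite (nodes G)" and E: "directed G \<subseteq> nodes G \<times> nodes G"
    using assms(1-3) by (auto simp: is_mdag_def)
  have G': "is_mdag ?G'"
    using assms(1) CN DN by (intro is_mdag_add_face) (auto simp: B_def)
  have sel: "nodes ?G' = nodes G" "directed ?G' = directed G" "faces ?G' = faces G \<union> Pow B"
    by (auto simp: add_face_def)
  \<comment> \<open>This is structural dominance: every facet of \<open>G\<close> is a face of the
    enlarged complex, so the same representation serves.\<close>
  have le: "mdag_model G c \<subseteq> mdag_model ?G' c" if c: "\<forall>v\<in>nodes G. 0 < c v" for c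
  proof
    fix P assume P: "P \<in> mdag_model G c"
    obtain q :: "'v set \<Rightarrow> nat pmf" and K
      where "latent_rep (nodes G) (directed G) c (facets G) (\<lambda>A. A) q K P"
      using mdag_model_imp_latent_rep[OF assms(1) _ P] c by blast
    then show "P \<in> mdag_model ?G' c"
      using set_pmf_mdag_model[OF P] finite_facets[OF assms(1)] sel
      by (intro latent_rep_imp_mdag_model[OF G', where I = "facets G" and ch = "\<lambda>A. A"])
        (auto simp: facets_def)
  qed
  have ge: "mdag_model ?G' c \<subseteq> mdag_model G c" if c: "\<forall>v\<in>nodes G. 0 < c v" for c
  proof (cases "B \<in> faces G")
    case True
    then have "faces G \<union> Pow B = faces G" using fc by blast
    then have "?G' = G" by (simp add: add_face_def)
    then show ?thesis by simp
  next
    case False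
    \<comment> \<open>If \<open>C\<close> were empty, \<open>B\<close> would be the face
      \<open>D\<close>.\<close>
    then have "C \<noteq> {}" using assms(3) by (auto simp: B_def)
    have B': "B \<in> facets ?G'"
    proof -
      have "A' = B" if "A' \<in> faces G \<or> A' \<subseteq> B" "B \<subseteq> A'" for A'
        using that False fc[of A' B] by blast
      then show ?thesis unfolding facets_def sel by blast
    qed
    have D': "D \<notin> facets ?G'"
    proof
      assume "D \<in> facets ?G'"
      then have "B = D"
        using facets_maximal[of D ?G' B] by (simp add: sel) (simp add: B_def)
      then show False using \<open>C \<noteq> {}\<close> assms(4) unfolding B_def by blast
    qed
    \<comment> \<open>The enlargement may swallow facets inside \<open>B\<close> but creates none
      besides \<open>B\<close>, so the second hypothesis on \<open>G\<close> applies to all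
      remaining ones.\<close>
    have old: "A \<in> facets G \<and> \<not> A \<subseteq> B" if "A \<in> facets ?G'" "A \<noteq> B" for A
    proof -
      have "\<not> A \<subseteq> B"
        using facets_maximal[OF that(1) facets_subset[OF B']] that(2) by blast
      moreover have "A \<in> faces G"
        using calculation facets_subset[OF that(1)] by (simp add: sel)
      ultimately show ?thesis
        using facets_maximal[OF that(1)] by (auto simp: facets_def sel)
    qed
    show ?thesis
    proof
      fix P assume P: "P \<in> mdag_model ?G' c"
      obtain q :: "'v set \<Rightarrow> nat pmf" and K
        where rep: "latent_rep (nodes G) (directed G) c (facets ?G') (\<lambda>A. A) q K P"
        using mdag_model_imp_latent_rep[OF G' _ P] c sel by metis
      have cov: "D \<subseteq> A" if "A \<in> facets ?G' - {B}" "A \<inter> C \<noteq> {}" for A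
      proof -
        have "A \<in> facets G" "\<not> A \<subseteq> C" using old that by (auto simp: B_def)
        moreover have "\<exists>c\<in>C. c \<in> A" using that by auto
        ultimately show ?thesis using assms(6) by blast
      qed
      \<comment> \<open>Latent variables are indexed by sets, so \<open>D\<close>, not being a facet, is a fresh index.\<close>
      obtain q' :: "'v set \<Rightarrow> nat pmf" and K'
        where rep': "latent_rep (nodes G) (directed G) c (insert D (facets ?G'))
          ((\<lambda>A. A)(B := C, D := D)) q' K' P"
        using latent_rep_split[OF V E finite_facets[OF G'] rep B' B_def D' CN DN assms(4) _ cov]
          assms(5) by blast
      show "P \<in> mdag_model G c"
      proof (rule latent_rep_imp_mdag_model[OF assms(1) _ _ _ rep'])
        show "set_pmf P \<subseteq> (\<Pi>\<^sub>E v\<in>nodes G. {..<c v})"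
          using set_pmf_mdag_model[OF P] sel by simp
        show "finite (insert D (facets ?G'))" using finite_facets[OF G'] by simp
        \<comment> \<open>Index \<open>B\<close> now has children \<open>C\<close> and index
          \<open>D\<close> has children \<open>D\<close>, both faces of \<open>G\<close>; the other
          indices are old facets.\<close>
        show "((\<lambda>A. A)(B := C, D := D)) A \<in> faces G" if "A \<in> insert D (facets ?G')" for A
          using that old[of A] assms(2,3) by (auto simp: facets_def)
      qed
    qed
  qed
  show ?thesis
    using le ge unfolding obs_dominates_def obs_equivalent_def B_def[symmetric]
    by (auto simp: sel)
qed

end
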